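(* Let $r>0$ be an integer. There exists $\ell_0=\ell_0(r)$ such that for every integer $\ell>\ell_0$, $$f_5(\ell,r)<(10\,\ell\log\ell)^{r+1}.$$
   Context: Graphs are finite, simple and undirected. For a graph $G=(V,E)$, $v\in V$ and a positive integer $r$, the $r$-ball $U_r(v,G)$ is the subgraph of $G$ induced on all vertices at graph distance at most $r$ from $v$. The $r$-local chromatic number of $G$ is $\ell\chi_r(G)=\max_{v\in V}\chi(U_r(v,G))$, where $\chi$ is the chromatic number. For integers $\ell\ge c\ge 2$ and $r>0$, $f_c(\ell,r)$ is the greatest integer $n$ such that every graph on $n$ vertices whose $r$-local chromatic number is at most $c$ is $\ell$-colorable. $\log$ is the natural logarithm. *)

theory Defs
  imports Complex_Main "Graph_Theory.Graph_Theory"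
begin

text \<open>
  Finite simple undirected graphs are represented by \<^locale>\<open>pair_graph\<close>: finite,
  loop-free, symmetric digraphs whose arcs are pairs of vertices, so an undirected
  edge is the pair of arcs (u, v) and (v, u).
\<close>

definition colorable :: "('a, 'b) pre_digraph \<Rightarrow> nat \<Rightarrow> bool" where
  "colorable G k \<longleftrightarrow>
     (\<exists>col :: 'a \<Rightarrow> nat. (\<forall>v \<in> verts G. col v < k) \<and>
        (\<forall>u v. u \<rightarrow>\<^bsub>G\<^esub> v \<longrightarrow> col u \<noteq> col v))"

definition chromatic_number :: "('a, 'b) pre_digraph \<Rightarrow> nat" where
  "chromatic_number G = (LEAST k. colorable G k)"

text \<open>
  The shortest-path distance with unit arc weights; it is infinite between different components.
\<close>

definition graph_dist :: "('a, 'b) pre_digraph \<Rightarrow> 'a \<Rightarrow> 'a \<Rightarrow> ereal" where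
  "graph_dist G u v = wf_digraph.\<mu> G (\<lambda>_. 1) u v"

definition graph_ball :: "nat \<Rightarrow> 'a \<Rightarrow> ('a, 'b) pre_digraph \<Rightarrow> ('a, 'b) pre_digraph" where
  "graph_ball r v G = G \<restriction> {u \<in> verts G. graph_dist G v u \<le> ereal (real r)}"

definition local_chromatic_number :: "nat \<Rightarrow> ('a, 'b) pre_digraph \<Rightarrow> nat" where
  "local_chromatic_number r G = Max ((\<lambda>v. chromatic_number (graph_ball r v G)) ` verts G)"

text \<open>
  Every finite graph is isomorphic to one whose vertices are natural numbers, so it
  suffices to quantify over the latter. For \<open>n = 0\<close> the property holds
  whatever the value of the maximum over the empty vertex set.
\<close>

definition locally_colorable_imp_colorable :: "nat \<Rightarrow> nat \<Rightarrow> nat \<Rightarrow> nat \<Rightarrow> bool" where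
  "locally_colorable_imp_colorable c l r n \<longleftrightarrow>
     (\<forall>G :: nat pair_pre_digraph.
        pair_graph G \<and> card (pverts G) = n \<and> local_chromatic_number r (with_proj G) \<le> c
          \<longrightarrow> colorable (with_proj G) l)"

text \<open>
  If no greatest such \<open>n\<close> exists, \<^const>\<open>Greatest\<close> is an unspecified number, so a
  bound on \<open>local_color_f\<close> must be accompanied by the existence of the greatest element.
\<close>

definition local_color_f :: "nat \<Rightarrow> nat \<Rightarrow> nat \<Rightarrow> nat" where
  "local_color_f c l r = (GREATEST n. locally_colorable_imp_colorable c l r n)"

end

theory Submission
  imports Defs "HOL-Real_Asymp.Real_Asymp"
begin

text \<open>
  Write \<open>L = l ln l\<close> and \<open>X = (10 L) ^ (r + 1)\<close>. A random graph on \<open>n < X\<close> vertices, \<open>n\<close> being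
  the largest such integer, with average degree about \<open>5 L / 2\<close>, is with positive probability
  not \<open>l\<close>-colourable although all its \<open>r\<close>-balls are \<open>5\<close>-colourable.

  It is not \<open>l\<close>-colourable because a first-moment bound excludes independent sets of size
  \<open>n / l\<close> (\<open>independent_bound\<close>). Its degrees are all below \<open>8 L\<close>, so every \<open>r\<close>-ball has at most
  \<open>s = (8 L) ^ r\<close> vertices.

  If an \<open>r\<close>-ball were not \<open>5\<close>-colourable, greedy colouring (\<open>degenerate_colouring\<close>) would
  yield a set \<open>W\<close> of \<open>t \<ge> 6\<close> vertices of the ball that spans a graph of minimum degree at least
  \<open>5\<close>, hence at least \<open>5 t / 2\<close> edges. A breadth-first tree of the ball accounts for at most
  \<open>t\<close> of these, which leaves a set \<open>F\<close> of \<open>\<lceil>3 t / 2\<rceil>\<close> further edges whose deletion does not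
  change the ball (\<open>surplus_edges\<close>). Given the graph without \<open>F\<close>, there are at most
  \<open>n (s choose t) ((t choose 2) choose |F|)\<close> possibilities for \<open>F\<close>, each contributing a factor
  \<open>q ^ |F|\<close> where \<open>q\<close> denotes the odds of an edge (\<open>sum_weight_deletion\<close>). As \<open>s q \<le> 1 / 5\<close>,
  the sum over \<open>t\<close> of these contributions is \<open>O(n / s ^ 3)\<close> (\<open>cluster_sum_bound\<close>), which tends
  to \<open>0\<close> as \<open>l\<close> grows.

  Adding isolated vertices gives counterexamples of all larger orders, so the greatest order
  without a counterexample exists and is less than \<open>n\<close>.
\<close>

section \<open>Balls, greedy colouring and surplus edges\<close>

text \<open>
  In the combinatorial part an undirected graph is its set \<open>E\<close> of edges, each edge
  being a two-element set of vertices. The following is the vertex set of the ball of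
  radius \<open>i\<close> around \<open>v\<close>; a vertex \<open>v\<close> that lies on no edge has the ball \<open>{v}\<close>.
\<close>

primrec edge_ball :: "'a set set \<Rightarrow> 'a \<Rightarrow> nat \<Rightarrow> 'a set" where
  "edge_ball E v 0 = {v}"
| "edge_ball E v (Suc i) = edge_ball E v i \<union> {w. \<exists>u\<in>edge_ball E v i. {u, w} \<in> E}"

lemma edge_ball_mono: "i \<le> j \<Longrightarrow> edge_ball E v i \<subseteq> edge_ball E v j"
  by (rule lift_Suc_mono_le[of "edge_ball E v"]) auto

text \<open>
  With all degrees below \<open>k\<close>, every closed neighbourhood has at most \<open>k\<close> vertices, so each
  step multiplies the size of the ball by at most \<open>k\<close>.
\<close>

lemma edge_ball_card:
  assumes deg: "\<And>x. finite {u. {x, u} \<in> E} \<and> card {u. {x, u} \<in> E} < k"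
  shows "finite (edge_ball E v i) \<and> card (edge_ball E v i) \<le> k ^ i"
proof (induction i)
  case 0
  show ?case by simp
next
  case (Suc i)
  let ?B = "edge_ball E v i"
  have eq: "edge_ball E v (Suc i) = (\<Union>x\<in>?B. insert x {u. {x, u} \<in> E})"
    by auto
  have "card (edge_ball E v (Suc i)) \<le> (\<Sum>x\<in>?B. card (insert x {u. {x, u} \<in> E}))"
    unfolding eq using Suc by (intro card_UN_le) auto
  also have "\<dots> \<le> (\<Sum>x\<in>?B. k)"
  proof (rule sum_mono)
    fix x
    have "card (insert x {u. {x, u} \<in> E}) \<le> Suc (card {u. {x, u} \<in> E})"
      by (simp add: card_insert_le_m1 card_insert_if deg)
    then show "card (insert x {u. {x, u} \<in> E}) \<le> k"
      using deg[of x] by linarith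
  qed
  also have "\<dots> \<le> k ^ Suc i"
    using Suc by simp
  finally show ?case
    unfolding eq using Suc deg by auto
qed

text \<open>
  Greedy colouring: if every nonempty \<open>W \<subseteq> S\<close> has a vertex with fewer than \<open>k\<close> neighbours
  in \<open>W\<close>, then \<open>S\<close> can be properly coloured with \<open>k\<close> colours.
\<close>

lemma degenerate_colouring:
  fixes R :: "'a \<Rightarrow> 'a \<Rightarrow> bool"
  assumes "finite S" "symp R" "irreflp R"
    and "\<And>W. W \<subseteq> S \<Longrightarrow> W \<noteq> {} \<Longrightarrow> \<exists>w\<in>W. card {u\<in>W. R w u} < k"
  shows "\<exists>c :: 'a \<Rightarrow> nat. (\<forall>v\<in>S. c v < k) \<and> (\<forall>u\<in>S. \<forall>v\<in>S. R u v \<longrightarrow> c u \<noteq> c v)"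
  using assms(1,4)
proof (induction S rule: finite_psubset_induct)
  case (psubset S)
  show ?case
  proof (cases "S = {}")
    case False
    then obtain w where w: "w \<in> S" "card {u\<in>S. R w u} < k"
      using psubset.prems[of S] by auto
    have "S - {w} \<subset> S" using w by auto
    moreover have "\<exists>w\<in>W. card {u\<in>W. R w u} < k" if "W \<subseteq> S - {w}" "W \<noteq> {}" for W
      using that psubset.prems[of W] by blast
    ultimately have "\<exists>c :: 'a \<Rightarrow> nat. (\<forall>v\<in>S-{w}. c v < k) \<and>
        (\<forall>u\<in>S-{w}. \<forall>v\<in>S-{w}. R u v \<longrightarrow> c u \<noteq> c v)"
      by (rule psubset.IH)
    then obtain c :: "'a \<Rightarrow> nat" where c: "\<forall>v\<in>S-{w}. c v < k"
      "\<forall>u\<in>S-{w}. \<forall>v\<in>S-{w}. R u v \<longrightarrow> c u \<noteq> c v"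
      by blast
    let ?N = "{u\<in>S. R w u}"
    have "card (c ` ?N) < card {..<k}"
      using w(2) card_image_le[of ?N c] psubset.hyps by simp
    then have "\<not> {..<k} \<subseteq> c ` ?N"
      using card_mono[of "c ` ?N" "{..<k}"] psubset.hyps by auto
    then obtain j where j: "j < k" "j \<notin> c ` ?N"
      by auto
    have sym: "R w u" if "R u w" for u using assms(2) that by (rule sympD)
    have "\<not> R w w" using assms(3) by (rule irreflpD)
    have "(c(w := j)) u \<noteq> (c(w := j)) v" if uv: "u \<in> S" "v \<in> S" "R u v" for u v
    proof -
      consider "u = w" "v \<noteq> w" | "v = w" "u \<noteq> w" | "u \<noteq> w" "v \<noteq> w"
        using uv(3) \<open>\<not> R w w\<close> by blast
      then show ?thesis
      proof cases
        case 1
        then have "c v \<in> c ` ?N" using uv by blast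
        then show ?thesis using 1 j(2) by auto
      next
        case 2
        then have "c u \<in> c ` ?N" using uv sym by blast
        then show ?thesis using 2 j(2) by auto
      next
        case 3
        then show ?thesis using uv c(2) by simp
      qed
    qed
    moreover have "\<forall>v\<in>S. (c(w := j)) v < k"
      using c(1) j(1) by simp
    ultimately show ?thesis by blast
  qed auto
qed

lemma handshake:
  assumes "finite W" and E: "\<And>e. e \<in> E \<Longrightarrow> card e = 2"
  shows "(\<Sum>w\<in>W. card {u\<in>W. {w, u} \<in> E}) = 2 * card {e\<in>E. e \<subseteq> W}"
proof -
  let ?EW = "{e\<in>E. e \<subseteq> W}"
  have finEW: "finite ?EW"
    by (rule finite_subset[of _ "Pow W"]) (use assms in auto)
  have "card {u\<in>W. {w, u} \<in> E} = card {e\<in>?EW. w \<in> e}" if "w \<in> W" for w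
  proof (rule bij_betw_same_card[of "\<lambda>u. {w, u}"])
    have "\<exists>u\<in>W. e = {w, u}" if "e \<in> E" "e \<subseteq> W" "w \<in> e" for e
      using E[OF that(1)] that by (auto simp: card_2_iff)
    then show "bij_betw (\<lambda>u. {w, u}) {u\<in>W. {w, u} \<in> E} {e\<in>?EW. w \<in> e}"
      using \<open>w \<in> W\<close> by (auto simp: bij_betw_def inj_on_def doubleton_eq_iff)
  qed
  then have "(\<Sum>w\<in>W. card {u\<in>W. {w, u} \<in> E}) = (\<Sum>w\<in>W. card {e\<in>?EW. w \<in> e})"
    by simp
  also have "\<dots> = 2 * card ?EW"
  proof (rule sum_multicount[OF assms(1) finEW])
    show "\<forall>e\<in>?EW. card {w\<in>W. w \<in> e} = 2"
    proof
      fix e assume "e \<in> ?EW"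
      then have "{w\<in>W. w \<in> e} = e" "card e = 2" using E by auto
      then show "card {w\<in>W. w \<in> e} = 2" by simp
    qed
  qed
  finally show ?thesis .
qed

text \<open>
  If a nonempty part \<open>W\<close> of a ball spans a graph of minimum degree at least \<open>5\<close>, it spans at
  least \<open>5|W|/2\<close> edges. At most \<open>|W|\<close> of them belong to a breadth-first tree of the ball, so
  \<open>\<lceil>3|W|/2\<rceil>\<close> edges within \<open>W\<close> can be deleted while that tree, and with it the ball, survives.
\<close>

lemma surplus_edges:
  assumes E: "\<And>e. e \<in> E \<Longrightarrow> card e = 2"
    and W: "W \<subseteq> edge_ball E v r" "finite W" "W \<noteq> {}"
    and deg: "\<And>w. w \<in> W \<Longrightarrow> 5 \<le> card {u\<in>W. {w, u} \<in> E}"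
  obtains F where "F \<subseteq> E" "F \<subseteq> {e. e \<subseteq> W \<and> card e = 2}" "card F = (3 * card W + 1) div 2"
    "W \<subseteq> edge_ball (E - F) v r" "6 \<le> card W"
proof -
  \<comment> \<open>The distance from \<open>v\<close>, and for every other vertex of the ball a parent that is closer to \<open>v\<close>.\<close>
  define lev where "lev u = (LEAST i. u \<in> edge_ball E v i)" for u
  have lev: "u \<in> edge_ball E v (lev u)" "lev u \<le> i" if "u \<in> edge_ball E v i" for u i
    unfolding lev_def using that by (auto intro: LeastI Least_le)
  have "\<exists>p. {p, u} \<in> E \<and> p \<in> edge_ball E v (lev u - 1)"
    if "u \<in> edge_ball E v i" "u \<noteq> v" for u i
  proof -
    from lev(1)[OF that(1)] that(2) obtain j where j: "lev u = Suc j"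
      by (cases "lev u") auto
    have "u \<notin> edge_ball E v j"
      using lev(2)[of u j] j by auto
    with lev(1)[OF that(1)] j show ?thesis by auto
  qed
  then obtain par where par: "\<And>u i. u \<in> edge_ball E v i \<Longrightarrow> u \<noteq> v \<Longrightarrow>
      {par u, u} \<in> E \<and> par u \<in> edge_ball E v (lev u - 1)"
    by metis
  \<comment> \<open>The edges of the breadth-first tree; a tree edge within \<open>W\<close> is determined by its child.\<close>
  define T where "T = (\<lambda>u. {par u, u}) ` (edge_ball E v r - {v})"
  define EW where "EW = {e\<in>E. e \<subseteq> W}"
  have finEW: "finite EW"
    unfolding EW_def by (rule finite_subset[of _ "Pow W"]) (use W in auto)
  have "EW \<inter> T \<subseteq> (\<lambda>u. {par u, u}) ` W"
    unfolding EW_def T_def by auto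
  then have cT: "card (EW \<inter> T) \<le> card W"
    using W(2) surj_card_le by blast
  have "5 * card W \<le> (\<Sum>w\<in>W. card {u\<in>W. {w, u} \<in> E})"
    using sum_mono[of W "\<lambda>_. 5" "\<lambda>w. card {u\<in>W. {w, u} \<in> E}"] deg by simp
  then have c5: "5 * card W \<le> 2 * card EW"
    using handshake[OF W(2) E] by (simp add: EW_def)
  have "card (EW - T) + card (EW \<inter> T) = card EW"
    using finEW by (metis card_Diff_subset_Int card_mono finite_Int inf_le1 le_add_diff_inverse2)
  then have "(3 * card W + 1) div 2 \<le> card (EW - T)"
    using cT c5 by linarith
  then obtain F where F: "F \<subseteq> EW - T" "card F = (3 * card W + 1) div 2"
    by (meson obtain_subset_with_card_n)
  have keep: "u \<in> edge_ball (E - F) v i" if "u \<in> edge_ball E v i" "i \<le> r" for u i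
    using that
  proof (induction i arbitrary: u)
    case (Suc i)
    show ?case
    proof (cases "u \<in> edge_ball E v i")
      case True
      with Suc show ?thesis by auto
    next
      case False
      have "u \<noteq> v"
        using False edge_ball_mono[of 0 i E v] by auto
      have "u \<in> edge_ball E v r"
        using Suc.prems edge_ball_mono[of "Suc i" r E v] by auto
      have "lev u - 1 \<le> i" using lev(2)[OF Suc.prems(1)] by linarith
      have "par u \<in> edge_ball E v i"
        using par[OF Suc.prems(1) \<open>u \<noteq> v\<close>] edge_ball_mono[OF \<open>lev u - 1 \<le> i\<close>, of E v]
        by blast
      then have "par u \<in> edge_ball (E - F) v i" using Suc by auto
      moreover have "{par u, u} \<in> T"
        unfolding T_def using \<open>u \<noteq> v\<close> \<open>u \<in> edge_ball E v r\<close> by auto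
      then have "{par u, u} \<in> E - F"
        using F par[OF Suc.prems(1) \<open>u \<noteq> v\<close>] by auto
      ultimately show ?thesis by auto
    qed
  qed auto
  obtain w where w: "w \<in> W" using W by auto
  have "{u\<in>W. {w, u} \<in> E} \<subseteq> W - {w}"
    using E[of "{w}"] by auto
  then have "card {u\<in>W. {w, u} \<in> E} \<le> card W - 1"
    using w W(2) card_mono[of "W - {w}" "{u\<in>W. {w, u} \<in> E}"] by simp
  then have "6 \<le> card W" using deg[OF w] by linarith
  moreover have "W \<subseteq> edge_ball (E - F) v r" using W keep by auto
  moreover have "F \<subseteq> E" "F \<subseteq> {e. e \<subseteq> W \<and> card e = 2}"
    using F E by (auto simp: EW_def)
  ultimately show ?thesis using that F(2) by blast
qed

section \<open>Weighted counting of random graphs\<close>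

text \<open>
  A random graph on the set \<open>P\<close> of potential edges with edge probability \<open>q / (1 + q)\<close> takes
  the value \<open>G \<subseteq> P\<close> with probability proportional to \<open>q ^ card G\<close>. Probabilities are
  represented by sums of these weights, with total weight \<open>(1 + q) ^ card P\<close>.
\<close>

lemma sum_weight_Pow:
  fixes q :: real
  assumes "finite P"
  shows "(\<Sum>G\<in>Pow P. q ^ card G) = (1 + q) ^ card P"
  using prod_add[OF assms, of "\<lambda>_. q" "\<lambda>_. 1"] by (simp add: add.commute)

text \<open>
  Deleting \<open>f\<close> edges divides the weight by \<open>q ^ f\<close>, and \<open>G \<mapsto> (G - F, F)\<close> is injective for
  \<open>F \<subseteq> G\<close>. So if every graph of an event contains a set \<open>F\<close> of \<open>f\<close> edges that is one of at
  most \<open>N\<close> sets determined by \<open>G - F\<close>, the event has probability at most \<open>N * q ^ f\<close>. That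
  the candidate sets may depend on the remaining graph replaces the conditioning on an
  exploration of the graph.
\<close>

lemma sum_weight_deletion:
  fixes q :: real
  assumes "finite P" "q \<ge> 0"
    and \<F>: "\<And>H. H \<subseteq> P \<Longrightarrow> finite (\<F> H) \<and> real (card (\<F> H)) \<le> N"
      "\<And>H F. H \<subseteq> P \<Longrightarrow> F \<in> \<F> H \<Longrightarrow> card F = f"
  shows "(\<Sum>G | G \<subseteq> P \<and> (\<exists>F. F \<in> \<F> (G - F) \<and> F \<subseteq> G). q ^ card G) \<le> N * q ^ f * (1 + q) ^ card P"
proof -
  let ?A = "{G. G \<subseteq> P \<and> (\<exists>F. F \<in> \<F> (G - F) \<and> F \<subseteq> G)}"
  have "\<forall>G\<in>?A. \<exists>F. F \<in> \<F> (G - F) \<and> F \<subseteq> G" by auto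
  from bchoice[OF this]
  obtain h where h: "\<And>G. G \<in> ?A \<Longrightarrow> h G \<in> \<F> (G - h G) \<and> h G \<subseteq> G"
    by auto
  let ?g = "\<lambda>G. (G - h G, h G)"
  have inj: "inj_on ?g ?A"
  proof (rule inj_onI)
    fix G G' assume "G \<in> ?A" "G' \<in> ?A" "?g G = ?g G'"
    moreover have "G = (G - h G) \<union> h G" "G' = (G' - h G') \<union> h G'"
      using h[OF \<open>G \<in> ?A\<close>] h[OF \<open>G' \<in> ?A\<close>] by auto
    ultimately show "G = G'" by auto
  qed
  have wt: "q ^ card G = q ^ f * q ^ card (G - h G)" if "G \<in> ?A" for G
  proof -
    have "finite G" using that assms(1) finite_subset by auto
    have "card (h G) = f" using \<F>(2)[of "G - h G" "h G"] h[OF that] that by auto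
    moreover have "card G = card (h G) + card (G - h G)"
      using h[OF that] \<open>finite G\<close>
      by (metis card_Diff_subset card_mono finite_subset le_add_diff_inverse)
    ultimately show ?thesis by (simp add: power_add)
  qed
  have "(\<Sum>G\<in>?A. q ^ card G) = (\<Sum>G\<in>?A. (\<lambda>(H, F). q ^ f * q ^ card H) (?g G))"
    by (rule sum.cong) (use wt in auto)
  also have "\<dots> = (\<Sum>(H, F)\<in>?g ` ?A. q ^ f * q ^ card H)"
    by (rule sum.reindex[OF inj, unfolded o_def, symmetric])
  also have "\<dots> \<le> (\<Sum>(H, F)\<in>Sigma (Pow P) \<F>. q ^ f * q ^ card H)"
    using h assms by (intro sum_mono2 finite_SigmaI) auto
  also have "\<dots> = (\<Sum>H\<in>Pow P. \<Sum>F\<in>\<F> H. q ^ f * q ^ card H)"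
    using assms by (subst sum.Sigma) auto
  also have "\<dots> = (\<Sum>H\<in>Pow P. real (card (\<F> H)) * (q ^ f * q ^ card H))"
    by simp
  also have "\<dots> \<le> (\<Sum>H\<in>Pow P. N * (q ^ f * q ^ card H))"
    using \<F> assms by (intro sum_mono mult_right_mono) auto
  also have "\<dots> = N * q ^ f * (1 + q) ^ card P"
    by (simp add: sum_weight_Pow[OF assms(1), symmetric] sum_distrib_left mult.assoc)
  finally show ?thesis .
qed

lemma sum_UN_le:
  fixes g :: "'b \<Rightarrow> real"
  assumes "finite I" "\<And>i. i \<in> I \<Longrightarrow> finite (A i)" "\<And>x. g x \<ge> 0"
  shows "sum g (\<Union>i\<in>I. A i) \<le> (\<Sum>i\<in>I. sum g (A i))"
  using assms(1,2)
proof (induction I rule: finite_induct)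
  case (insert i I)
  have "sum g (A i \<union> (\<Union>j\<in>I. A j)) \<le> sum g (A i) + sum g (\<Union>j\<in>I. A j)"
    using insert assms(3) by (subst sum_Un) (auto intro!: sum_nonneg)
  with insert show ?case by simp
qed simp

text \<open>
  The three summands of the hypothesis bound the probabilities of an independent set of size
  \<open>a\<close>, of a vertex of degree at least \<open>k\<close>, and, when all degrees are below \<open>k\<close>, of a part \<open>W\<close>
  of some ball, \<open>t = card W\<close>, that spans a graph of minimum degree at least \<open>5\<close>. If they add
  up to less than \<open>1\<close>, some graph avoids all three.
\<close>

lemma locally_degenerate_graph_exists:
  fixes q :: real and n a k r :: nat
  assumes "q > 0" "k > 0"
    and total: "real (n choose a) / (1 + q) ^ (a choose 2) + real n * real (n choose k) * q ^ k
      + (\<Sum>t=6..k^r. real n * real ((k ^ r) choose t) *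
          real ((t choose 2) choose ((3 * t + 1) div 2)) * q ^ ((3 * t + 1) div 2)) < 1"
  obtains E where "E \<subseteq> {e. e \<subseteq> {..<n} \<and> card e = 2}"
    "\<And>A. A \<subseteq> {..<n} \<Longrightarrow> card A = a \<Longrightarrow> \<exists>e\<in>E. e \<subseteq> A"
    "\<And>v W. W \<subseteq> edge_ball E v r \<Longrightarrow> finite W \<Longrightarrow> W \<noteq> {} \<Longrightarrow> \<exists>w\<in>W. card {u\<in>W. {w, u} \<in> E} < 5"
proof -
  define pairs where "pairs A = {e. e \<subseteq> A \<and> card e = 2}" for A :: "nat set"
  have fin_pairs: "finite (pairs A)" and card_pairs': "card (pairs A) = card A choose 2"
    if "finite A" for A
    using that n_subsets[OF that, of 2] by (auto simp: pairs_def)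
  define P where "P = pairs {..<n}"
  have finP: "finite P" by (simp add: P_def fin_pairs)
  define Z where "Z = (1 + q) ^ card P"
  have "Z > 0" using \<open>q > 0\<close> by (simp add: Z_def)
  define deg_ok where "deg_ok H \<longleftrightarrow> (\<forall>v. card {u. {v, u} \<in> H} < k)" for H :: "nat set set"
  have nbrs: "{u. {v, u} \<in> H} \<subseteq> {..<n}" "{u. {v, u} \<in> H} \<noteq> {} \<Longrightarrow> v < n"
    if "H \<subseteq> P" for v H
    using that by (fastforce simp: P_def pairs_def)+
  have deg_fin: "finite {u. {v, u} \<in> H}" if "H \<subseteq> P" for v H
    using nbrs(1)[OF that] finite_subset by blast
  let ?S = "\<lambda>X. \<Sum>G\<in>X. q ^ card (G :: nat set set)"

  \<comment> \<open>The three kinds of bad graphs: with a large independent set, with a vertex of large degree,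
    with a dense part of a ball.\<close>
  define XA where "XA = {G. G \<subseteq> P \<and> (\<exists>A\<subseteq>{..<n}. card A = a \<and> G \<inter> pairs A = {})}"
  define XB where "XB = {G. G \<subseteq> P \<and> \<not> deg_ok G}"
  define XC where "XC = {G. G \<subseteq> P \<and> deg_ok G \<and> (\<exists>v<n. \<exists>W\<subseteq>edge_ball G v r.
    finite W \<and> W \<noteq> {} \<and> (\<forall>w\<in>W. 5 \<le> card {u\<in>W. {w, u} \<in> G}))}"

  have SA: "?S XA \<le> real (n choose a) / (1 + q) ^ (a choose 2) * Z"
  proof -
    let ?I = "{A. A \<subseteq> {..<n} \<and> card A = a}"
    have fI: "finite ?I" by simp
    have cI: "card ?I = n choose a" using n_subsets[of "{..<n}" a] by simp
    have "?S XA \<le> ?S (\<Union>A\<in>?I. Pow (P - pairs A))"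
      unfolding XA_def using \<open>q > 0\<close> finP by (intro sum_mono2) auto
    also have "\<dots> \<le> (\<Sum>A\<in>?I. ?S (Pow (P - pairs A)))"
      using \<open>q > 0\<close> finP by (intro sum_UN_le) auto
    also have "\<dots> = (\<Sum>A\<in>?I. Z / (1 + q) ^ (a choose 2))"
    proof (rule sum.cong[OF refl])
      fix A assume A: "A \<in> ?I"
      have "pairs A \<subseteq> P" "finite A" using A finite_subset by (auto simp: pairs_def P_def)
      then have "card (P - pairs A) = card P - (a choose 2)" "a choose 2 \<le> card P"
        using A card_pairs' finP by (auto simp: card_Diff_subset fin_pairs dest: card_mono[rotated])
      then show "?S (Pow (P - pairs A)) = Z / (1 + q) ^ (a choose 2)"
        using finP \<open>q > 0\<close> by (simp add: sum_weight_Pow Z_def power_diff)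
    qed
    also have "\<dots> = real (n choose a) / (1 + q) ^ (a choose 2) * Z"
      using cI by simp
    finally show ?thesis .
  qed

  have SB: "?S XB \<le> real n * real (n choose k) * q ^ k * Z"
  proof -
    let ?I = "{..<n} \<times> {A. A \<subseteq> {..<n} \<and> card A = k}"
    let ?F = "(\<lambda>(v, A). (\<lambda>u. {v, u}) ` A) ` ?I"
    have fI: "finite ?I" by simp
    have cI: "card ?I = n * (n choose k)"
      using n_subsets[of "{..<n}" k] by (simp add: card_cartesian_product)
    have inj: "inj (\<lambda>u. {v, u})" for v :: nat
      by (auto simp: inj_on_def doubleton_eq_iff)
    have "?S XB \<le> ?S {G. G \<subseteq> P \<and> (\<exists>F. F \<in> ?F \<and> F \<subseteq> G)}"
    proof (rule sum_mono2)
      show "XB \<subseteq> {G. G \<subseteq> P \<and> (\<exists>F. F \<in> ?F \<and> F \<subseteq> G)}"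
      proof
        fix G assume "G \<in> XB"
        then obtain v where G: "G \<subseteq> P" and v: "k \<le> card {u. {v, u} \<in> G}"
          by (auto simp: XB_def deg_ok_def not_less)
        then obtain A where A: "A \<subseteq> {u. {v, u} \<in> G}" "card A = k"
          by (meson obtain_subset_with_card_n)
        have "v < n" using nbrs(2)[OF G, of v] v \<open>k > 0\<close> by (metis card.empty not_le)
        moreover have "A \<subseteq> {..<n}" using A nbrs(1)[OF G] by blast
        ultimately have "(\<lambda>u. {v, u}) ` A \<in> ?F" using A by force
        moreover have "(\<lambda>u. {v, u}) ` A \<subseteq> G" using A by auto
        ultimately show "G \<in> {G. G \<subseteq> P \<and> (\<exists>F. F \<in> ?F \<and> F \<subseteq> G)}"
          using G by blast
      qed
    qed (use finP \<open>q > 0\<close> in auto)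
    also have "\<dots> \<le> real (n * (n choose k)) * q ^ k * Z"
      unfolding Z_def
    proof (rule sum_weight_deletion[OF finP])
      show "finite ?F \<and> real (card ?F) \<le> real (n * (n choose k))"
      proof
        have "card ?F \<le> n * (n choose k)"
          using card_image_le[OF fI, of "\<lambda>(v, A). (\<lambda>u. {v, u}) ` A"] unfolding cI .
        then show "real (card ?F) \<le> real (n * (n choose k))"
          by (simp only: of_nat_le_iff)
      qed (use fI in auto)
      show "card F = k" if "F \<in> ?F" for F
        using that card_image[OF inj_on_subset[OF inj subset_UNIV]] by auto
    qed (use \<open>q > 0\<close> in auto)
    finally show ?thesis by simp
  qed

  \<comment> \<open>The candidates for the surplus edges of a dense part of \<open>t\<close> vertices, read off from the graph
    \<open>H\<close> that is left when they are deleted. Balls of \<open>H\<close> have at most \<open>k ^ r\<close> vertices, which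
    bounds the number of candidates.\<close>
  define f where "f t = (3 * t + 1) div 2" for t :: nat
  define \<F> where "\<F> t H = (if deg_ok H then
      (\<Union>v<n. \<Union>W\<in>{W. W \<subseteq> edge_ball H v r \<and> card W = t}. {F. F \<subseteq> pairs W \<and> card F = f t}) else {})"
    for t H
  define N where "N t = real n * real ((k ^ r) choose t) * real ((t choose 2) choose f t)" for t
  have card_F: "finite (\<F> t H) \<and> real (card (\<F> t H)) \<le> N t" if "H \<subseteq> P" for t H
  proof (cases "deg_ok H")
    case True
    define I where "I v = {W. W \<subseteq> edge_ball H v r \<and> card W = t}" for v
    define J where "J W = {F. F \<subseteq> pairs W \<and> card F = f t}" for W
    have ball: "finite (edge_ball H v r)" "card (edge_ball H v r) \<le> k ^ r" for v
      using edge_ball_card[of H k v r] True deg_fin[OF that] by (auto simp: deg_ok_def)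
    have fI: "finite (I v)" for v using ball by (simp add: I_def)
    have cI: "card (I v) \<le> (k ^ r) choose t" for v
      using n_subsets[OF ball(1), of v t] binomial_right_mono[OF ball(2)] by (simp add: I_def)
    have finW: "finite W" if "W \<in> I v" for v W using that ball finite_subset by (auto simp: I_def)
    have J: "finite (J W)" "card (J W) = (t choose 2) choose f t" if "W \<in> I v" for v W
      using finW[OF that] n_subsets[OF fin_pairs, of W "f t"] that
      by (auto simp: J_def I_def fin_pairs card_pairs')
    have "card (\<Union>v<n. \<Union>W\<in>I v. J W) \<le> (\<Sum>v<n. card (\<Union>W\<in>I v. J W))"
      using fI J by (intro card_UN_le) auto
    also have "\<dots> \<le> (\<Sum>v<n. \<Sum>W\<in>I v. card (J W))"
      using fI by (intro sum_mono card_UN_le) auto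
    also have "\<dots> = (\<Sum>v<n. card (I v) * ((t choose 2) choose f t))"
      using J by simp
    also have "\<dots> \<le> (\<Sum>v<n. ((k ^ r) choose t) * ((t choose 2) choose f t))"
      using cI by (intro sum_mono mult_right_mono) auto
    finally have "card (\<Union>v<n. \<Union>W\<in>I v. J W) \<le> n * (((k ^ r) choose t) * ((t choose 2) choose f t))"
      by simp
    then have "real (card (\<Union>v<n. \<Union>W\<in>I v. J W)) \<le> N t"
      unfolding N_def by (metis of_nat_le_iff of_nat_mult mult.assoc)
    moreover have "\<F> t H = (\<Union>v<n. \<Union>W\<in>I v. J W)"
      using True by (simp add: \<F>_def I_def J_def)
    ultimately show ?thesis using fI J by auto
  qed (simp add: \<F>_def N_def)
  have SC: "?S XC \<le> (\<Sum>t=6..k^r. N t * q ^ f t) * Z"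
  proof -
    let ?Y = "\<lambda>t. {G. G \<subseteq> P \<and> (\<exists>F. F \<in> \<F> t (G - F) \<and> F \<subseteq> G)}"
    have "XC \<subseteq> (\<Union>t\<in>{6..k^r}. ?Y t)"
    proof
      fix G assume "G \<in> XC"
      then have "\<exists>v<n. \<exists>W\<subseteq>edge_ball G v r.
          finite W \<and> W \<noteq> {} \<and> (\<forall>w\<in>W. 5 \<le> card {u\<in>W. {w, u} \<in> G})"
        and G: "G \<subseteq> P" "deg_ok G"
        unfolding XC_def by blast+
      then obtain v W where "v < n"
        and W: "W \<subseteq> edge_ball G v r" "finite W" "W \<noteq> {}"
          "\<And>w. w \<in> W \<Longrightarrow> 5 \<le> card {u\<in>W. {w, u} \<in> G}"
        by blast
      have G2: "card e = 2" if "e \<in> G" for e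
        using G(1) that by (auto simp: P_def pairs_def)
      obtain F where F: "F \<subseteq> G" "F \<subseteq> {e. e \<subseteq> W \<and> card e = 2}" "card F = (3 * card W + 1) div 2"
        "W \<subseteq> edge_ball (G - F) v r" "6 \<le> card W"
        using surplus_edges[OF G2 W] by blast
      have "deg_ok (G - F)"
        unfolding deg_ok_def
      proof
        fix v
        have "card {u. {v, u} \<in> G - F} \<le> card {u. {v, u} \<in> G}"
          by (rule card_mono[OF deg_fin[OF G(1)]]) auto
        then show "card {u. {v, u} \<in> G - F} < k"
          using G(2) by (auto simp: deg_ok_def dest: spec[of _ v])
      qed
      then have "F \<in> \<F> (card W) (G - F)"
        using F \<open>v < n\<close> by (auto simp: \<F>_def f_def pairs_def)
      moreover have "card W \<le> k ^ r"
      proof -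
        have "finite (edge_ball G v r) \<and> card (edge_ball G v r) \<le> k ^ r"
          using edge_ball_card[of G k v r] G(2) deg_fin[OF G(1)] by (auto simp: deg_ok_def)
        then show ?thesis using W(1) card_mono le_trans by blast
      qed
      ultimately show "G \<in> (\<Union>t\<in>{6..k^r}. ?Y t)"
        using F G by auto
    qed
    then have "?S XC \<le> ?S (\<Union>t\<in>{6..k^r}. ?Y t)"
      using finP \<open>q > 0\<close> by (intro sum_mono2) auto
    also have "\<dots> \<le> (\<Sum>t=6..k^r. ?S (?Y t))"
      using \<open>q > 0\<close> finP by (intro sum_UN_le) auto
    also have "\<dots> \<le> (\<Sum>t=6..k^r. N t * q ^ f t * Z)"
      unfolding Z_def using finP \<open>q > 0\<close> card_F
      by (intro sum_mono sum_weight_deletion) (auto simp: \<F>_def split: if_splits)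
    finally show ?thesis by (simp add: sum_distrib_right)
  qed

  have "?S (XA \<union> XB \<union> XC) \<le> ?S XA + ?S XB + ?S XC"
  proof -
    have fin: "finite XA" "finite XB" "finite XC"
      using finP by (auto simp: XA_def XB_def XC_def)
    then have "?S (XA \<union> XB \<union> XC) \<le> ?S (XA \<union> XB) + ?S XC"
      using \<open>q > 0\<close> by (simp add: sum_Un sum_nonneg)
    moreover have "?S (XA \<union> XB) \<le> ?S XA + ?S XB"
      using \<open>q > 0\<close> fin by (simp add: sum_Un sum_nonneg)
    ultimately show ?thesis by linarith
  qed
  also have "\<dots> \<le> (real (n choose a) / (1 + q) ^ (a choose 2) + real n * real (n choose k) * q ^ k
      + (\<Sum>t=6..k^r. N t * q ^ f t)) * Z"
    using SA SB SC by (simp add: distrib_right)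
  also have "\<dots> < 1 * Z"
    using total \<open>Z > 0\<close> by (intro mult_strict_right_mono) (simp_all add: N_def f_def)
  also have "1 * Z = ?S (Pow P)"
    by (simp add: sum_weight_Pow finP Z_def)
  finally have "\<not> Pow P \<subseteq> XA \<union> XB \<union> XC"
    using sum_mono2[of "XA \<union> XB \<union> XC" "Pow P" "\<lambda>G. q ^ card G"] finP \<open>q > 0\<close>
    by (auto simp: XA_def XB_def XC_def)
  then obtain E where E: "E \<subseteq> P" "E \<notin> XA" "E \<notin> XB" "E \<notin> XC" by auto
  show thesis
  proof
    show "E \<subseteq> {e. e \<subseteq> {..<n} \<and> card e = 2}"
      using E(1) by (simp add: P_def pairs_def)
    show "\<exists>e\<in>E. e \<subseteq> A" if "A \<subseteq> {..<n}" "card A = a" for A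
      using E(1,2) that by (auto simp: XA_def pairs_def)
    show "\<exists>w\<in>W. card {u\<in>W. {w, u} \<in> E} < 5"
      if W: "W \<subseteq> edge_ball E v r" "finite W" "W \<noteq> {}" for v W
    proof (cases "v < n")
      case True
      have "deg_ok E" using E by (auto simp: XB_def)
      then show ?thesis
        using E(1,4) W True unfolding XC_def by (auto simp: not_less[symmetric])
    next
      case False
      \<comment> \<open>No edge contains \<open>v\<close>, so its ball is trivial.\<close>
      have "edge_ball E v i = {v}" for i
        by (induction i) (use False nbrs(2)[OF E(1), of v] in auto)
      then have "W = {v}" using W by auto
      moreover have "card {u\<in>{v}. {v, u} \<in> E} \<le> card {v}"
        by (rule card_mono) auto
      ultimately show ?thesis by auto
    qed
  qed
qed

section \<open>From edge sets to local chromatic numbers\<close>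

lemma graph_dist_le_imp_edge_ball:
  assumes "wf_digraph (with_proj G)" and arcs: "\<And>x y. (x, y) \<in> parcs G \<Longrightarrow> {x, y} \<in> E"
    and "graph_dist (with_proj G) v u \<le> ereal (real r)"
  shows "u \<in> edge_ball E v r"
proof -
  interpret W: wf_digraph "with_proj G" by fact
  have "W.\<mu> (\<lambda>_. 1) v u < ereal (real r + 1)"
    using assms(3) unfolding graph_dist_def by (rule le_less_trans) simp
  then obtain p where p: "W.awalk v p u" "W.awalk_cost (\<lambda>_. 1) p < real r + 1"
    unfolding W.\<mu>_def by (auto simp: INF_less_iff)
  have "W.awalk_cost (\<lambda>_. 1) p = real (length p)"
    by (induction p) auto
  then have "length p \<le> r" using p(2) by linarith
  have "set p \<subseteq> parcs G \<Longrightarrow> pcas x p u \<Longrightarrow> x \<in> edge_ball E v i \<Longrightarrow> u \<in> edge_ball E v (i + length p)"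
    for x i
  proof (induction p arbitrary: x i)
    case (Cons e p)
    have "{x, snd e} \<in> E" using Cons.prems arcs[of x "snd e"] by auto
    then have "snd e \<in> edge_ball E v (Suc i)" using Cons.prems by auto
    then show ?case using Cons.IH[of "snd e" "Suc i"] Cons.prems by simp
  qed simp
  from this[of v 0] have "u \<in> edge_ball E v (length p)"
    using p(1) by (simp add: W.awalk_def cas_with_proj_eq)
  then show ?thesis using edge_ball_mono[OF \<open>length p \<le> r\<close>, of E v] by blast
qed

text \<open>
  Isolated vertices do not affect the properties of the graph, so a graph on \<open>n\<close> vertices
  yields a counterexample of every order \<open>m \<ge> n\<close>. The graph is not \<open>l\<close>-colourable, for
  otherwise some colour class would contain \<open>a\<close> of its \<open>n > l (a - 1)\<close> first vertices.
\<close>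

lemma not_locally_colorable_imp_colorable:
  fixes E :: "nat set set"
  assumes E: "E \<subseteq> {e. e \<subseteq> {..<n} \<and> card e = 2}"
    and dense: "\<And>A. A \<subseteq> {..<n} \<Longrightarrow> card A = a \<Longrightarrow> \<exists>e\<in>E. e \<subseteq> A"
    and sparse: "\<And>v W. W \<subseteq> edge_ball E v r \<Longrightarrow> finite W \<Longrightarrow> W \<noteq> {} \<Longrightarrow>
      \<exists>w\<in>W. card {u\<in>W. {w, u} \<in> E} < c"
    and "l * (a - 1) < n" "0 < a" "n \<le> m"
  shows "\<not> locally_colorable_imp_colorable c l r m"
proof -
  \<comment> \<open>The vertices from \<open>n\<close> to \<open>m - 1\<close> are isolated.\<close>
  define G where "G = \<lparr>pverts = {..<m}, parcs = {(x, y). {x, y} \<in> E}\<rparr>"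
  have edge: "x < n" "y < n" "x \<noteq> y" if "{x, y} \<in> E" for x y
    using E that by auto
  have pG: "pair_graph G"
  proof
    show "finite (parcs G)"
      by (rule finite_subset[of _ "{..<n} \<times> {..<n}"]) (use edge in \<open>auto simp: G_def\<close>)
    show "symmetric (with_proj G)"
      by (auto simp: symmetric_def G_def sym_def insert_commute)
  qed (use edge \<open>n \<le> m\<close> in \<open>force simp: G_def\<close>)+
  interpret pair_graph G by (rule pG)
  have wf: "wf_digraph (with_proj G)" by unfold_locales
  have ball: "colorable (graph_ball r v (with_proj G)) c" for v
  proof -
    define S where "S = {u \<in> verts (with_proj G). graph_dist (with_proj G) v u \<le> ereal (real r)}"
    have "S \<subseteq> edge_ball E v r"
      using graph_dist_le_imp_edge_ball[OF wf, of E v _ r] by (auto simp: S_def G_def)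
    moreover have "finite S" by (simp add: S_def G_def)
    ultimately have "\<exists>w\<in>W. card {u\<in>W. {w, u} \<in> E} < c" if "W \<subseteq> S" "W \<noteq> {}" for W
      using sparse[of W v] that by (meson finite_subset subset_trans)
    then have "\<exists>col :: nat \<Rightarrow> nat. (\<forall>v\<in>S. col v < c) \<and>
        (\<forall>u\<in>S. \<forall>v\<in>S. {u, v} \<in> E \<longrightarrow> col u \<noteq> col v)"
      using edge(3) by (intro degenerate_colouring \<open>finite S\<close>)
        (auto simp: symp_def irreflp_def insert_commute dest: edge(3)[of x x for x, simplified])
    then show ?thesis
      unfolding colorable_def graph_ball_def S_def[symmetric]
      by (auto simp: arcs_ends_conv G_def)
  qed
  have "local_chromatic_number r (with_proj G) \<le> c"
    unfolding local_chromatic_number_def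
  proof (rule Max.boundedI)
    show "(\<lambda>v. chromatic_number (graph_ball r v (with_proj G))) ` verts (with_proj G) \<noteq> {}"
      using \<open>l * (a - 1) < n\<close> \<open>n \<le> m\<close> by (auto simp: G_def lessThan_empty_iff)
  qed (auto simp: chromatic_number_def G_def intro!: Least_le ball[unfolded G_def])
  moreover have "\<not> colorable (with_proj G) l"
  proof
    assume "colorable (with_proj G) l"
    then obtain col :: "nat \<Rightarrow> nat" where col: "\<And>v. v < m \<Longrightarrow> col v < l"
      "\<And>u v. {u, v} \<in> E \<Longrightarrow> col u \<noteq> col v"
      unfolding colorable_def by (auto simp: G_def)
    have "\<exists>i<l. a \<le> card {v\<in>{..<n}. col v = i}"
    proof (rule ccontr)
      assume "\<not> ?thesis"
      then have small: "card {v\<in>{..<n}. col v = i} \<le> a - 1" if "i < l" for i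
        using that by (force simp: not_le)
      have "{..<n} = (\<Union>i<l. {v\<in>{..<n}. col v = i})"
        using col(1) \<open>n \<le> m\<close> by auto
      then have "n = card (\<Union>i<l. {v\<in>{..<n}. col v = i})" by (metis card_lessThan)
      also have "\<dots> \<le> (\<Sum>i<l. card {v\<in>{..<n}. col v = i})"
        by (rule card_UN_le) simp
      also have "\<dots> \<le> (\<Sum>i<l. a - 1)"
        using small by (intro sum_mono) auto
      finally show False using \<open>l * (a - 1) < n\<close> by simp
    qed
    then obtain i A where A: "A \<subseteq> {v\<in>{..<n}. col v = i}" "card A = a"
      by (meson obtain_subset_with_card_n)
    then obtain e where e: "e \<in> E" "e \<subseteq> A"
      using dense[of A] by auto
    then obtain x y where "e = {x, y}"
      using E by (auto simp: card_2_iff)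
    then show False using e A col(2)[of x y] by auto
  qed
  ultimately show ?thesis
    unfolding locally_colorable_imp_colorable_def using pG by (auto simp: G_def)
qed

lemma locally_colorable_imp_colorable_0: "locally_colorable_imp_colorable c l r 0"
proof -
  have "colorable (with_proj G) l" if "pair_graph G" "card (pverts G) = 0" for G :: "nat pair_pre_digraph"
  proof -
    interpret pair_graph G by fact
    have "pverts G = {}" using that(2) pair_finite_verts by simp
    then show ?thesis
      unfolding colorable_def using in_arcsD1 by auto
  qed
  then show ?thesis by (auto simp: locally_colorable_imp_colorable_def)
qed

lemma local_color_f_less:
  assumes "\<And>m. n \<le> m \<Longrightarrow> \<not> locally_colorable_imp_colorable c l r m"
  shows "\<exists>g. locally_colorable_imp_colorable c l r g \<and>
      (\<forall>m. locally_colorable_imp_colorable c l r m \<longrightarrow> m \<le> g)"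
    and "local_color_f c l r < n"
proof -
  let ?P = "locally_colorable_imp_colorable c l r"
  have bd: "\<forall>m. ?P m \<longrightarrow> m \<le> n" using assms nat_le_linear by blast
  have g: "?P (Greatest ?P)"
    using GreatestI_nat[of ?P 0 n] bd locally_colorable_imp_colorable_0 by blast
  have "?P m \<Longrightarrow> m \<le> Greatest ?P" for m
    using Greatest_le_nat[of ?P m n] bd by blast
  with g show "\<exists>g. ?P g \<and> (\<forall>m. ?P m \<longrightarrow> m \<le> g)" by blast
  show "local_color_f c l r < n"
    unfolding local_color_f_def using g assms not_less by blast
qed

section \<open>Estimates\<close>

lemma binomial_le_exp_power:
  assumes "k > 0"
  shows "real (n choose k) \<le> (3 * real n / real k) ^ k"
proof -
  have "real k ^ k / fact k \<le> exp (real k)"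
  proof -
    have "(\<Sum>i\<in>{k}. real k ^ i / fact i) \<le> (\<Sum>i. real k ^ i / fact i)"
      using summable_exp_generic[of "real k"]
      by (intro sum_le_suminf) (auto simp: scaleR_conv_of_real field_simps)
    then show ?thesis
      by (simp add: exp_def scaleR_conv_of_real field_simps)
  qed
  also have "\<dots> = exp 1 ^ k"
    by (simp add: exp_of_nat_mult[symmetric])
  also have "\<dots> \<le> 3 ^ k"
    using exp_le by (intro power_mono) auto
  finally have "real k ^ k \<le> 3 ^ k * fact k"
    by (simp add: field_simps)
  then have "real (n choose k) * real k ^ k \<le> real (n choose k) * (3 ^ k * fact k)"
    by (intro mult_left_mono) auto
  also have "\<dots> = 3 ^ k * real ((n choose k) * fact k)"
    by simp
  also have "\<dots> \<le> 3 ^ k * real (n ^ k)"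
    using binomial_fact_pow[of n k] by (intro mult_left_mono) (simp_all only: of_nat_le_iff, simp)
  finally show ?thesis
    using assms by (simp add: power_mult_distrib power_divide field_simps)
qed

text \<open>
  The expected number of dense parts of size \<open>t\<close> of a ball of size \<open>s\<close>. By the bound
  \<open>(n choose k) \<le> (3 n / k) ^ k\<close> its square is at most
  \<open>((3 s / t)\<^sup>2 (t q) ^ 3) ^ t = (9 (s q) ^ 3 (t / s)) ^ t\<close>; the exponents are such that a
  factor \<open>t / s\<close> remains, of which six powers are kept.
\<close>

lemma cluster_term_bound:
  fixes q :: real and s t :: nat
  assumes "6 \<le> t" "t \<le> s" "0 \<le> q" "real s * q \<le> 1 / 5"
  shows "real (s choose t) * real ((t choose 2) choose ((3 * t + 1) div 2)) * q ^ ((3 * t + 1) div 2)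
    \<le> (1 / 2) ^ t * (real t / real s) ^ 3"
proof -
  \<comment> \<open>The estimate is carried out for the square, as \<open>f\<close> is about \<open>3 t / 2\<close>.\<close>
  define f where "f = (3 * t + 1) div 2"
  have f: "3 * t \<le> 2 * f" "f > 0" using assms by (auto simp: f_def)
  have pos: "real t > 0" "real s > 0" using assms by auto
  have ts: "real t / real s \<le> 1" using assms by simp
  have b1: "real (s choose t) \<le> (3 * real s / real t) ^ t"
    using assms by (intro binomial_le_exp_power) simp
  have "real (t choose 2) \<le> real t * real t / 2"
    by (simp add: choose_two real_of_nat_div algebra_simps)
  have b2: "real ((t choose 2) choose f) \<le> real t ^ f"
  proof -
    have "real ((t choose 2) choose f) \<le> (3 * real (t choose 2) / real f) ^ f"
      using f by (intro binomial_le_exp_power)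
    also have "\<dots> \<le> real t ^ f"
    proof (rule power_mono)
      have "3 * real (t choose 2) \<le> real t * (3 * real t / 2)"
        using \<open>real (t choose 2) \<le> real t * real t / 2\<close> by simp
      also have "\<dots> \<le> real t * real f"
        using f(1) by (intro mult_left_mono) auto
      finally show "3 * real (t choose 2) / real f \<le> real t"
        using f by (simp add: field_simps)
    qed simp
    finally show ?thesis .
  qed
  have "real t * q \<le> real s * q" using assms by (intro mult_right_mono) auto
  then have tq: "0 \<le> real t * q" "real t * q \<le> 1" using assms by auto
  let ?T = "real (s choose t) * real ((t choose 2) choose f) * q ^ f"
  have "?T \<le> (3 * real s / real t) ^ t * real t ^ f * q ^ f"
    using b1 b2 assms by (intro mult_right_mono mult_mono) auto
  also have "\<dots> = (3 * real s / real t) ^ t * (real t * q) ^ f"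
    by (simp add: power_mult_distrib)
  finally have "?T\<^sup>2 \<le> ((3 * real s / real t) ^ t * (real t * q) ^ f)\<^sup>2"
    using assms by (intro power_mono) auto
  also have "\<dots> = ((3 * real s / real t)\<^sup>2) ^ t * (real t * q) ^ (2 * f)"
    by (simp add: power_mult_distrib power_mult[symmetric] mult.commute)
  also have "\<dots> \<le> ((3 * real s / real t)\<^sup>2) ^ t * (real t * q) ^ (3 * t)"
    using f tq by (intro mult_left_mono power_decreasing) auto
  also have "\<dots> = ((3 * real s / real t)\<^sup>2 * (real t * q) ^ 3) ^ t"
    by (simp add: power_mult_distrib power_mult)
  also have "(3 * real s / real t)\<^sup>2 * (real t * q) ^ 3 = 9 * (real s * q) ^ 3 * (real t / real s)"
    using pos by (simp add: field_simps power2_eq_square power3_eq_cube)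
  also have "(9 * (real s * q) ^ 3 * (real t / real s)) ^ t \<le> (1 / 4 * (real t / real s)) ^ t"
  proof (intro power_mono mult_right_mono)
    have "(real s * q) ^ 3 \<le> (1 / 5) ^ 3"
      using assms by (intro power_mono) auto
    then show "9 * (real s * q) ^ 3 \<le> 1 / 4" by (simp add: power3_eq_cube)
  qed (use assms in auto)
  also have "\<dots> = (1 / 4) ^ t * (real t / real s) ^ t"
    by (simp only: power_mult_distrib)
  also have "\<dots> \<le> (1 / 4) ^ t * (real t / real s) ^ 6"
    using assms ts by (intro mult_left_mono power_decreasing) auto
  also have "\<dots> = ((1 / 2) ^ t * (real t / real s) ^ 3)\<^sup>2"
  proof -
    have "((1 / 2) ^ t)\<^sup>2 = ((1 / 2)\<^sup>2 :: real) ^ t"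
      by (simp only: power_mult[symmetric] mult.commute)
    then have "((1 / 2) ^ t)\<^sup>2 = (1 / 4 :: real) ^ t"
      by (simp add: power2_eq_square)
    moreover have "((real t / real s) ^ 3)\<^sup>2 = (real t / real s) ^ 6"
      by (simp flip: power_mult)
    ultimately show ?thesis
      by (simp only: power_mult_distrib)
  qed
  finally have "?T \<le> (1 / 2) ^ t * (real t / real s) ^ 3"
    by (rule power2_le_imp_le) simp
  then show ?thesis by (simp add: f_def)
qed

lemma sum_cubes_half_powers: "(\<Sum>t\<le>N. real t ^ 3 * (1 / 2) ^ t) \<le> 26"
proof -
  have "(\<Sum>t\<le>N. real t ^ 3 * (1 / 2) ^ t) =
    26 - (real N ^ 3 + 6 * real N ^ 2 + 18 * real N + 26) * (1 / 2) ^ N"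
    by (induction N) (simp_all add: field_simps power2_eq_square power3_eq_cube)
  also have "\<dots> \<le> 26" by simp
  finally show ?thesis .
qed

lemma cluster_sum_bound:
  fixes q :: real and s n :: nat
  assumes "0 < s" "0 \<le> q" "real s * q \<le> 1 / 5"
  shows "(\<Sum>t=6..s. real n * real (s choose t) *
      real ((t choose 2) choose ((3 * t + 1) div 2)) * q ^ ((3 * t + 1) div 2)) \<le> 26 * real n / real s ^ 3"
proof -
  have "(\<Sum>t=6..s. real n * real (s choose t) *
      real ((t choose 2) choose ((3 * t + 1) div 2)) * q ^ ((3 * t + 1) div 2))
    \<le> (\<Sum>t=6..s. real n / real s ^ 3 * (real t ^ 3 * (1 / 2) ^ t))"
  proof (rule sum_mono)
    fix t assume "t \<in> {6..s}"
    then have "real n * (real (s choose t) * real ((t choose 2) choose ((3 * t + 1) div 2)) * q ^ ((3 * t + 1) div 2))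
      \<le> real n * ((1 / 2) ^ t * (real t / real s) ^ 3)"
      using assms by (intro mult_left_mono cluster_term_bound) auto
    then show "real n * real (s choose t) *
      real ((t choose 2) choose ((3 * t + 1) div 2)) * q ^ ((3 * t + 1) div 2)
      \<le> real n / real s ^ 3 * (real t ^ 3 * (1 / 2) ^ t)"
      by (simp add: power_divide mult_ac)
  qed
  also have "\<dots> = real n / real s ^ 3 * (\<Sum>t=6..s. real t ^ 3 * (1 / 2) ^ t)"
    by (simp add: sum_distrib_left)
  also have "\<dots> \<le> real n / real s ^ 3 * (\<Sum>t\<le>s. real t ^ 3 * (1 / 2) ^ t)"
    by (intro mult_left_mono sum_mono2) auto
  also have "\<dots> \<le> real n / real s ^ 3 * 26"
    by (intro mult_left_mono sum_cubes_half_powers) auto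
  also have "\<dots> = 26 * real n / real s ^ 3"
    by simp
  finally show ?thesis .
qed

text \<open>
  Here \<open>M\<close> is a lower bound for the exponent gained per vertex of an independent set, through
  \<open>ln (1 + q) \<ge> q - q\<^sup>2\<close>.
\<close>

lemma independent_bound:
  fixes q M :: real and n a l :: nat
  assumes "0 < a" "real n \<le> real l * real a" "0 \<le> q" "q \<le> 1"
    and M: "M \<le> (real a - 1) / 2 * (q - q\<^sup>2)" "3 * real l * exp (- M) \<le> \<epsilon>" "\<epsilon> \<le> 1"
  shows "real (n choose a) / (1 + q) ^ (a choose 2) \<le> \<epsilon>"
proof -
  have ev: "even (a * (a - 1))" by (cases a) auto
  have c2: "real (a choose 2) = real a * ((real a - 1) / 2)"
    using assms(1) ev by (simp add: choose_two real_of_nat_div of_nat_diff)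
  have "real a * M \<le> real a * ((real a - 1) / 2 * (q - q\<^sup>2))"
    using M(1) by (intro mult_left_mono) auto
  also have "\<dots> = real (a choose 2) * (q - q\<^sup>2)"
    by (simp add: c2)
  also have "\<dots> \<le> real (a choose 2) * ln (1 + q)"
    using assms by (intro mult_left_mono ln_one_plus_pos_lower_bound) auto
  finally have "exp (real a * M) \<le> exp (real (a choose 2) * ln (1 + q))"
    by simp
  also have "\<dots> = (1 + q) ^ (a choose 2)"
    using assms by (simp add: exp_of_nat_mult)
  finally have den: "exp (real a * M) \<le> (1 + q) ^ (a choose 2)" .
  have "real (n choose a) \<le> (3 * real n / real a) ^ a"
    using assms by (intro binomial_le_exp_power)
  also have "\<dots> \<le> (3 * real l) ^ a"
    using assms by (intro power_mono) (auto simp: field_simps)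
  finally have "real (n choose a) / (1 + q) ^ (a choose 2) \<le> (3 * real l) ^ a / exp (real a * M)"
    using den by (intro frac_le) auto
  also have "\<dots> = (3 * real l * exp (- M)) ^ a"
    by (simp only: exp_of_nat_mult power_mult_distrib exp_minus power_inverse divide_inverse)
  also have "\<dots> \<le> (3 * real l * exp (- M)) ^ 1"
    using assms by (intro power_decreasing) auto
  finally show ?thesis using M by simp
qed

lemma poly_times_geometric_small:
  fixes c :: real
  assumes "c > 0"
  obtains K where "\<And>k. k \<ge> K \<Longrightarrow> (2 * real k) ^ m * (19 / 20) ^ k < c"
proof -
  have "(\<lambda>k. (2 * real k) ^ m * (19 / 20) ^ k) \<longlonglongrightarrow> 0"
    by real_asymp
  from order_tendstoD(2)[OF this assms] show ?thesis
    using that by (auto simp: eventually_sequentially)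
qed

section \<open>The upper bound\<close>

theorem theorem3p1:
  fixes r :: nat
  assumes "r > 0"
  shows "\<exists>l0 :: nat. \<forall>l :: nat. l > l0 \<longrightarrow>
    (\<exists>n. locally_colorable_imp_colorable 5 l r n \<and>
         (\<forall>m. locally_colorable_imp_colorable 5 l r m \<longrightarrow> m \<le> n)) \<and>
    real (local_color_f 5 l r) < (10 * real l * ln (real l)) ^ (r + 1)"
proof -
  obtain K1 where K1: "\<And>k. k \<ge> K1 \<Longrightarrow> (2 * real k) ^ (r + 1) * (19 / 20) ^ k < 1 / 4"
    using poly_times_geometric_small[of "1 / 4" "r + 1"] by auto
  \<comment> \<open>The three lower bounds on \<open>l\<close> serve the degrees, the dense parts of balls and the independent
    sets, in this order.\<close>
  define l0 where "l0 = Max {K1, 104 * 2 ^ (r + 1), nat \<lceil>exp 20 :: real\<rceil>}"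
  show ?thesis
  proof (intro exI[of _ l0] allI impI)
    fix l :: nat assume "l > l0"
    then have l: "l \<ge> K1" "l > 104 * 2 ^ (r + 1)" "real l \<ge> exp 20"
      by (auto simp: l0_def) linarith
    \<comment> \<open>The odds \<open>q\<close> give an expected degree of about \<open>5 L / 2\<close>, enough for independent sets to be
      smaller than \<open>n / l\<close>, since the threshold is \<open>2 L\<close>. Degrees stay below \<open>8 L\<close>, as
      \<open>3 * (5 / 2) < 8\<close> in the tail bound, and \<open>n\<close> is the largest integer below \<open>X\<close>.\<close>
    define L where "L = real l * ln (real l)"
    define X where "X = (10 * L) ^ (r + 1)"
    define q where "q = 5 * L / (2 * X)"
    define n where "n = nat \<lceil>X\<rceil> - 1"
    define k where "k = nat \<lfloor>8 * L\<rfloor>"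
    define a where "a = nat \<lceil>real n / real l\<rceil>"

    have lpos: "real l > 0" using l(3) exp_gt_zero[of "20 :: real"] by linarith
    have lnl: "ln (real l) \<ge> 20" using l(3) lpos by (simp add: ln_ge_iff)
    have "(1 :: nat) \<le> 2 ^ r" by simp
    then have "l \<ge> 200" using l(2) unfolding power_add power_one_right by linarith
    have L: "20 * real l \<le> L"
      unfolding L_def using lnl lpos by (simp add: mult.commute)
    then have "L \<ge> 3000" using \<open>l \<ge> 200\<close> by simp
    have X2: "100 * L\<^sup>2 \<le> X"
    proof -
      have "(10 * L) ^ 2 \<le> (10 * L) ^ (r + 1)"
        using \<open>L \<ge> 3000\<close> \<open>r > 0\<close> by (intro power_increasing) auto
      then show ?thesis by (simp add: X_def power_mult_distrib)
    qed
    have "300000 * L \<le> 100 * L\<^sup>2"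
      using \<open>L \<ge> 3000\<close> by (simp add: power2_eq_square)
    with X2 have XL: "300000 * L \<le> X" by linarith
    have "X > 0" using XL \<open>L \<ge> 3000\<close> by linarith
    have n: "real n < X" "X - 1 \<le> real n"
      using \<open>X > 0\<close> unfolding n_def by (auto simp: of_nat_diff) linarith+
    have "n > 0" using n(2) XL \<open>L \<ge> 3000\<close> by (cases n) auto
    have k: "real k \<le> 8 * L" "8 * L - 1 \<le> real k"
      using \<open>L \<ge> 3000\<close> unfolding k_def by linarith+
    have "l \<le> k" using k(2) L \<open>L \<ge> 3000\<close> by linarith
    have "k > 0" using \<open>l \<le> k\<close> \<open>l \<ge> 200\<close> by linarith
    have "0 < real n / real l" using \<open>n > 0\<close> lpos by simp
    then have a: "real n / real l \<le> real a" "real a < real n / real l + 1"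
      unfolding a_def by linarith+
    have "a > 0" using a(1) \<open>0 < real n / real l\<close> by (cases a) auto
    have "real l * (real a - 1) < real n"
      using a(2) lpos by (simp add: field_simps)
    moreover have "real (l * (a - 1)) = real l * (real a - 1)"
      using \<open>a > 0\<close> by (simp add: of_nat_diff)
    ultimately have la: "l * (a - 1) < n"
      by (metis of_nat_less_iff)
    have q: "0 < q" "q \<le> 1 / 100"
      using XL \<open>L \<ge> 3000\<close> \<open>X > 0\<close> by (auto simp: q_def field_simps)
    have Xq: "X * q = 5 / 2 * L" using \<open>X > 0\<close> by (simp add: q_def)

    \<comment> \<open>With \<open>M = 6 / 5 * ln l\<close> the bound for independent sets becomes \<open>3 * l powr (- 1 / 5)\<close>.\<close>
    have A: "real (n choose a) / (1 + q) ^ (a choose 2) \<le> 1 / 4"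
    proof (rule independent_bound)
      show "real n \<le> real l * real a"
        using a(1) lpos by (simp add: field_simps)
      have "1 + real l \<le> X / 100" using XL L \<open>L \<ge> 3000\<close> by linarith
      then have "X * 99 / 100 \<le> real n - real l" using n(2) by linarith
      then have "X * 99 / 100 / real l \<le> (real n - real l) / real l"
        using lpos by (intro divide_right_mono) auto
      also have "\<dots> = real n / real l - 1" using lpos by (simp add: field_simps)
      also have "\<dots> \<le> real a - 1" using a(1) by linarith
      finally have a1: "X * 99 / 100 / real l \<le> real a - 1" .
      have "q\<^sup>2 \<le> q * (1 / 100)"
        using q by (simp add: power2_eq_square)
      then have q1: "q * (99 / 100) \<le> q - q\<^sup>2" by linarith
      have "6 / 5 * ln (real l) \<le> 99 / 100 * (99 / 100) * (5 / 4) * ln (real l)"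
        using lnl by simp
      also have "\<dots> = (X * q) * (99 / 100 / real l / 2 * (99 / 100))"
        using lpos unfolding Xq L_def by simp
      also have "\<dots> = (X * 99 / 100 / real l) / 2 * (q * (99 / 100))"
        by simp
      also have "\<dots> \<le> (real a - 1) / 2 * (q - q\<^sup>2)"
        using a1 q1 q \<open>a > 0\<close> by (intro mult_mono divide_right_mono) auto
      finally show "6 / 5 * ln (real l) \<le> (real a - 1) / 2 * (q - q\<^sup>2)" .
      have "12 \<le> exp (1 / 5 * ln (real l))"
      proof -
        have "12 \<le> exp (4 :: real)"
          using exp_lower_Taylor_quadratic[of "4 :: real"] by simp
        also have "\<dots> \<le> exp (1 / 5 * ln (real l))"
          using lnl by simp
        finally show ?thesis .
      qed
      moreover have "real l * exp (- (6 / 5 * ln (real l))) = exp (- (1 / 5 * ln (real l)))"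
      proof -
        have "real l = exp (ln (real l))" using lpos by simp
        then have "real l * exp (- (6 / 5 * ln (real l))) = exp (ln (real l)) * exp (- (6 / 5 * ln (real l)))"
          by simp
        also have "\<dots> = exp (- (1 / 5 * ln (real l)))"
          unfolding exp_add[symmetric] by (rule arg_cong[of _ _ exp]) (simp add: algebra_simps)
        finally show ?thesis .
      qed
      ultimately show "3 * real l * exp (- (6 / 5 * ln (real l))) \<le> 1 / 4"
        by (simp add: exp_minus field_simps)
    qed (use q \<open>a > 0\<close> in auto)

    \<comment> \<open>Expressed in \<open>k\<close>, which is about \<open>8 L\<close>, the remaining two bounds tend to \<open>0\<close> for fixed \<open>r\<close>.\<close>
    have X_k: "X \<le> (2 * real k) ^ (r + 1)"
      unfolding X_def using k(2) \<open>L \<ge> 3000\<close> by (intro power_mono) linarith+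
    have B: "real n * real (n choose k) * q ^ k < 1 / 4"
    proof -
      have "real n * q \<le> 5 / 2 * L"
        using n(1) q(1) unfolding Xq[symmetric] by (intro mult_right_mono) auto
      then have "3 * real n / real k * q \<le> 19 / 20"
        using k(2) \<open>L \<ge> 3000\<close> \<open>k > 0\<close> by (simp add: field_simps)
      have "real n * real (n choose k) * q ^ k \<le> X * ((3 * real n / real k) ^ k * q ^ k)"
        unfolding mult.assoc using n(1) \<open>X > 0\<close> q(1) binomial_le_exp_power[OF \<open>k > 0\<close>, of n]
        by (intro mult_mono) auto
      also have "\<dots> = X * (3 * real n / real k * q) ^ k"
        by (simp only: power_mult_distrib)
      also have "\<dots> \<le> (2 * real k) ^ (r + 1) * (19 / 20) ^ k"
        using \<open>3 * real n / real k * q \<le> 19 / 20\<close> X_k q(1) by (intro mult_mono power_mono) auto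
      also have "\<dots> < 1 / 4"
        using K1 l(1) \<open>l \<le> k\<close> by simp
      finally show ?thesis .
    qed

    have "(\<Sum>t=6..k^r. real n * real ((k ^ r) choose t) *
          real ((t choose 2) choose ((3 * t + 1) div 2)) * q ^ ((3 * t + 1) div 2))
        \<le> 26 * real n / real (k ^ r) ^ 3"
    proof (rule cluster_sum_bound)
      have "real k ^ r \<le> (8 * L) ^ r"
        using k(1) by (intro power_mono) auto
      then have "real (k ^ r) * q \<le> (8 * L) ^ r * q"
        using q(1) by (simp only: of_nat_power mult_right_mono less_imp_le)
      also have "\<dots> = (8 / 10) ^ r * (1 / 4)"
      proof -
        have "(8 * L) ^ r = (8 / 10) ^ r * (10 * L) ^ r"
          by (subst power_mult_distrib[symmetric]) simp
        moreover have "(10 * L) ^ r * q = 1 / 4"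
          using \<open>L \<ge> 3000\<close> by (simp add: q_def X_def)
        ultimately show ?thesis by (simp only: mult.assoc)
      qed
      also have "\<dots> \<le> (8 / 10) ^ 1 * (1 / 4)"
        using \<open>r > 0\<close> by (intro mult_right_mono power_decreasing) auto
      finally show "real (k ^ r) * q \<le> 1 / 5" by simp
    qed (use \<open>k > 0\<close> q in auto)
    also have "\<dots> < 1 / 4"
    proof -
      \<comment> \<open>This uses \<open>r + 2 \<le> 3 r\<close>: at least six vertices in a dense part make up for the \<open>n\<close>
        choices of the centre.\<close>
      have "real k ^ (r + 1) * real k \<le> real k ^ (3 * r)"
        unfolding power_Suc2[symmetric] using \<open>r > 0\<close> \<open>k > 0\<close> by (intro power_increasing) auto
      have "real (104 * 2 ^ (r + 1)) < real l" using l(2) by (simp only: of_nat_less_iff)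
      then have kl: "104 * 2 ^ (r + 1) < real k" using \<open>l \<le> k\<close> by simp
      have "104 * real n \<le> 104 * 2 ^ (r + 1) * real k ^ (r + 1)"
        using n(1) X_k unfolding power_mult_distrib by linarith
      also have "\<dots> < real k * real k ^ (r + 1)"
        using kl \<open>k > 0\<close> by (intro mult_strict_right_mono) auto
      also have "\<dots> \<le> real (k ^ r) ^ 3"
        using \<open>real k ^ (r + 1) * real k \<le> real k ^ (3 * r)\<close>
        by (simp add: mult.commute flip: power_mult)
      finally show ?thesis using \<open>k > 0\<close> by (simp add: field_simps)
    qed
    finally have total: "real (n choose a) / (1 + q) ^ (a choose 2) + real n * real (n choose k) * q ^ k
      + (\<Sum>t=6..k^r. real n * real ((k ^ r) choose t) *
          real ((t choose 2) choose ((3 * t + 1) div 2)) * q ^ ((3 * t + 1) div 2)) < 1"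
      using A B by linarith
    obtain E where E: "E \<subseteq> {e. e \<subseteq> {..<n} \<and> card e = 2}"
      "\<And>A. A \<subseteq> {..<n} \<Longrightarrow> card A = a \<Longrightarrow> \<exists>e\<in>E. e \<subseteq> A"
      "\<And>v W. W \<subseteq> edge_ball E v r \<Longrightarrow> finite W \<Longrightarrow> W \<noteq> {} \<Longrightarrow> \<exists>w\<in>W. card {u\<in>W. {w, u} \<in> E} < 5"
      by (rule locally_degenerate_graph_exists[OF q(1) \<open>k > 0\<close> total]) blast
    have fails: "\<not> locally_colorable_imp_colorable 5 l r m" if "n \<le> m" for m
      using not_locally_colorable_imp_colorable[OF E la \<open>a > 0\<close> that] .
    have "real (local_color_f 5 l r) < X"
      using local_color_f_less(2)[of n 5 l r, OF fails] n(1) by linarith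
    then show "(\<exists>n. locally_colorable_imp_colorable 5 l r n \<and>
         (\<forall>m. locally_colorable_imp_colorable 5 l r m \<longrightarrow> m \<le> n)) \<and>
      real (local_color_f 5 l r) < (10 * real l * ln (real l)) ^ (r + 1)"
      using local_color_f_less(1)[of n 5 l r, OF fails] by (simp add: X_def L_def mult.assoc)
  qed
qed

end
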